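(* Let $\Omega\subset\mathbb{R}^s$ be a compact domain, $f\in C(\Omega)$, and let $\langle\cdot,\cdot\rangle_N$ be the discrete scalar product determined by an $N$-point quadrature rule with positive weights $w_j$ and nodes $\mathbf{x}_j\in\Omega$ having algebraic degree of exactness $2L$. Let $\lambda>0$ and $\mu_1,\ldots,\mu_d>0$. Then the hybrid hyperinterpolant $$\mathscr{H}_L^{\lambda}f=\sum_{\ell=1}^{d}h\!\left(\frac{\deg\Phi_\ell}{L}\right)\mathscr{S}_{\lambda\mu_\ell}\big(\langle f,\Phi_\ell\rangle_N\big)\,\Phi_\ell\in\mathbb{P}_L(\Omega)$$ is the solution to the regularized least squares approximation problem $$\min_{p_\lambda\in\mathbb{P}_L(\Omega)}\left\{\frac12\sum_{j=1}^{N}w_j\,[p_\lambda(\mathbf{x}_j)-f(\mathbf{x}_j)]^2+\frac12\sum_{j=1}^{N}w_j\,[\mathcal{R}_Lp_\lambda(\mathbf{x}_j)]^2+\lambda\sum_{\ell=1}^{d}\mu_\ell|\beta_\ell^{\lambda}|\right\},$$ where $p_\lambda=\sum_{\ell=1}^{d}\beta_\ell^{\lambda}\Phi_\ell$ and $\mathcal{R}_Lp_\lambda=\sum_{\ell=1}^{d}b_\ell\beta_\ell^{\lambda}\Phi_\ell$, with the convention that for indices $\ell$ with $\deg\Phi_\ell=L$ (for which $b_\ell=\infty$) the coefficient $\beta_\ell^{\lambda}$ is constrained to be $0$ and the corresponding term of $\mathcal{R}_Lp_\lambda$ is taken to be $0$.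
   Context: $\Omega\subset\mathbb{R}^s$ is compact and carries a positive measure $\omega$ with $\int_\Omega d\omega=V<\infty$. $C(\Omega)$ is the space of continuous real functions on $\Omega$. $\langle f,g\rangle=\int_\Omega fg\,d\omega$. $L\ge1$ is an integer; $\mathbb{P}_n(\Omega)$ is the space of (restrictions to $\Omega$ of) polynomials of total degree at most $n$; $d=\dim\mathbb{P}_L(\Omega)$; $\{\Phi_1,\ldots,\Phi_d\}\subset\mathbb{P}_L(\Omega)$ is a basis of $\mathbb{P}_L(\Omega)$ orthonormal for $\langle\cdot,\cdot\rangle$, and $\deg\Phi_\ell\in\{0,\ldots,L\}$ is the total degree of $\Phi_\ell$. Quadrature: nodes $\mathbf{x}_1,\ldots,\mathbf{x}_N\in\Omega$ and weights $w_1,\ldots,w_N>0$ have algebraic degree of exactness $2L$ if $\sum_{j=1}^N w_jp(\mathbf{x}_j)=\int_\Omega p\,d\omega$ for all $p\in\mathbb{P}_{2L}(\Omega)$. The discrete scalar product is $\langle f,g\rangle_N=\sum_{j=1}^N w_jf(\mathbf{x}_j)g(\mathbf{x}_j)$ for $f,g\in C(\Omega)$. Filter: $h(x)=1$ for $x\in[0,1/2]$ and $h(x)=\sin^2(\pi x)$ for $x\in[1/2,1]$; $h_\ell:=h(\deg\Phi_\ell/L)$. Soft thresholding: for $k\ge0$, $\mathscr{S}_k(a)=a+k$ if $a<-k$, $\mathscr{S}_k(a)=0$ if $-k\le a\le k$, $\mathscr{S}_k(a)=a-k$ if $a>k$. Coefficients $b_\ell$: $b_\ell=0$ if $\deg\Phi_\ell/L\in[0,1/2]$,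 and $b_\ell=\sqrt{1/h_\ell-1}$ if $\deg\Phi_\ell/L\in[1/2,1)$; for $\deg\Phi_\ell=L$ one has $h_\ell=0$, formally $b_\ell=\infty$, which forces $\beta_\ell^\lambda=0$. *)

theory Defs
  imports "HOL-Analysis.Analysis" "HOL-Library.Function_Algebras"
begin

definition fun_scale :: "real \<Rightarrow> ('a \<Rightarrow> real) \<Rightarrow> 'a \<Rightarrow> real" where
  "fun_scale c f = (\<lambda>x. c * f x)"

global_interpretation fun_vs: vector_space "fun_scale :: real \<Rightarrow> ('a \<Rightarrow> real) \<Rightarrow> 'a \<Rightarrow> real"
  by unfold_locales (auto simp: fun_scale_def fun_eq_iff algebra_simps)

definition monomial :: "('s \<Rightarrow> nat) \<Rightarrow> real ^ 's::finite \<Rightarrow> real" where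
  "monomial a x = (\<Prod>i\<in>UNIV. (x $ i) ^ a i)"

(* A function on \<Omega> is encoded by its extension by 0 to the whole space, so that HOL equality of
   the encodings is equality on \<Omega>. *)
definition restr :: "'a set \<Rightarrow> ('a \<Rightarrow> real) \<Rightarrow> 'a \<Rightarrow> real" where
  "restr \<Omega> p = (\<lambda>x. if x \<in> \<Omega> then p x else 0)"

definition poly_space :: "nat \<Rightarrow> (real ^ 's::finite) set \<Rightarrow> (real ^ 's \<Rightarrow> real) set" where
  "poly_space n \<Omega> = restr \<Omega> ` fun_vs.span {monomial a |a. (\<Sum>i\<in>UNIV. a i) \<le> n}"

(* If polynomials of different degrees agree on \<Omega> (e.g. on a sphere), the total degree of the
   restriction is the least degree of a representing polynomial.  It is 0 for the zero function. *)
definition total_deg :: "(real ^ 's::finite) set \<Rightarrow> (real ^ 's \<Rightarrow> real) \<Rightarrow> nat" where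
  "total_deg \<Omega> p = (LEAST n. p \<in> poly_space n \<Omega>)"

(* Only inclusion of the Borel sets of \<Omega> is required, so completed measures are covered too. *)
definition finite_measure_on :: "(real ^ 's::finite) set \<Rightarrow> (real ^ 's) measure \<Rightarrow> bool" where
  "finite_measure_on \<Omega> \<omega> \<longleftrightarrow>
     space \<omega> = \<Omega> \<and> sets (restrict_space borel \<Omega>) \<subseteq> sets \<omega> \<and> finite_measure \<omega>"

definition ip :: "'a measure \<Rightarrow> ('a \<Rightarrow> real) \<Rightarrow> ('a \<Rightarrow> real) \<Rightarrow> real" where
  "ip \<omega> f g = integral\<^sup>L \<omega> (\<lambda>x. f x * g x)"

definition orthonormal_poly_basis ::
  "(real ^ 's::finite) set \<Rightarrow> (real ^ 's) measure \<Rightarrow> nat \<Rightarrow> nat \<Rightarrow> (nat \<Rightarrow> real ^ 's \<Rightarrow> real) \<Rightarrow> bool" where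
  "orthonormal_poly_basis \<Omega> \<omega> L d \<Phi> \<longleftrightarrow>
     d = fun_vs.dim (poly_space L \<Omega>) \<and>
     inj_on \<Phi> {1..d} \<and>
     fun_vs.independent (\<Phi> ` {1..d}) \<and>
     fun_vs.span (\<Phi> ` {1..d}) = poly_space L \<Omega> \<and>
     (\<forall>k\<in>{1..d}. \<forall>l\<in>{1..d}. ip \<omega> (\<Phi> k) (\<Phi> l) = (if k = l then 1 else 0))"

definition positive_quadrature ::
  "'a set \<Rightarrow> nat \<Rightarrow> (nat \<Rightarrow> 'a) \<Rightarrow> (nat \<Rightarrow> real) \<Rightarrow> bool" where
  "positive_quadrature \<Omega> N x w \<longleftrightarrow> (\<forall>j\<in>{1..N}. x j \<in> \<Omega> \<and> w j > 0)"

definition exact_of_degree ::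
  "(real ^ 's::finite) set \<Rightarrow> (real ^ 's) measure \<Rightarrow> nat \<Rightarrow> (nat \<Rightarrow> real ^ 's) \<Rightarrow> (nat \<Rightarrow> real) \<Rightarrow> nat \<Rightarrow> bool" where
  "exact_of_degree \<Omega> \<omega> N x w m \<longleftrightarrow>
     (\<forall>p\<in>poly_space m \<Omega>. (\<Sum>j=1..N. w j * p (x j)) = integral\<^sup>L \<omega> p)"

definition discrete_ip ::
  "nat \<Rightarrow> (nat \<Rightarrow> 'a) \<Rightarrow> (nat \<Rightarrow> real) \<Rightarrow> ('a \<Rightarrow> real) \<Rightarrow> ('a \<Rightarrow> real) \<Rightarrow> real" where
  "discrete_ip N x w f g = (\<Sum>j=1..N. w j * f (x j) * g (x j))"

(* Meaningful on [0,1] only. *)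
definition filter_h :: "real \<Rightarrow> real" where
  "filter_h t = (if t \<le> 1/2 then 1 else (sin (pi * t))\<^sup>2)"

definition soft_threshold :: "real \<Rightarrow> real \<Rightarrow> real" where
  "soft_threshold k a = (if a < -k then a + k else if a \<le> k then 0 else a - k)"

definition hybrid_hyperinterpolant ::
  "(real ^ 's::finite) set \<Rightarrow> nat \<Rightarrow> nat \<Rightarrow> (nat \<Rightarrow> real ^ 's \<Rightarrow> real) \<Rightarrow>
   nat \<Rightarrow> (nat \<Rightarrow> real ^ 's) \<Rightarrow> (nat \<Rightarrow> real) \<Rightarrow> real \<Rightarrow> (nat \<Rightarrow> real) \<Rightarrow>
   (real ^ 's \<Rightarrow> real) \<Rightarrow> real ^ 's \<Rightarrow> real" where
  "hybrid_hyperinterpolant \<Omega> L d \<Phi> N x w lam \<mu> f =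
     (\<lambda>y. \<Sum>l=1..d. filter_h (real (total_deg \<Omega> (\<Phi> l)) / real L)
                   * soft_threshold (lam * \<mu> l) (discrete_ip N x w f (\<Phi> l)) * \<Phi> l y)"

definition basis_coeff ::
  "nat \<Rightarrow> (nat \<Rightarrow> 'a \<Rightarrow> real) \<Rightarrow> ('a \<Rightarrow> real) \<Rightarrow> nat \<Rightarrow> real" where
  "basis_coeff d \<Phi> p l = fun_vs.representation (\<Phi> ` {1..d}) p (\<Phi> l)"

(* For degree L this coefficient would be infinite; it is never used there, see reg_op and
   admissible. *)
definition reg_coeff :: "nat \<Rightarrow> nat \<Rightarrow> real" where
  "reg_coeff L k =
     (if real k / real L \<le> 1/2 then 0 else sqrt (1 / filter_h (real k / real L) - 1))"

definition reg_op ::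
  "(real ^ 's::finite) set \<Rightarrow> nat \<Rightarrow> nat \<Rightarrow> (nat \<Rightarrow> real ^ 's \<Rightarrow> real) \<Rightarrow>
   (real ^ 's \<Rightarrow> real) \<Rightarrow> real ^ 's \<Rightarrow> real" where
  "reg_op \<Omega> L d \<Phi> p =
     (\<lambda>y. \<Sum>l=1..d. if total_deg \<Omega> (\<Phi> l) = L then 0
                   else reg_coeff L (total_deg \<Omega> (\<Phi> l)) * basis_coeff d \<Phi> p l * \<Phi> l y)"

definition admissible ::
  "(real ^ 's::finite) set \<Rightarrow> nat \<Rightarrow> nat \<Rightarrow> (nat \<Rightarrow> real ^ 's \<Rightarrow> real) \<Rightarrow> (real ^ 's \<Rightarrow> real) \<Rightarrow> bool" where
  "admissible \<Omega> L d \<Phi> p \<longleftrightarrow>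
     p \<in> poly_space L \<Omega> \<and>
     (\<forall>l\<in>{1..d}. total_deg \<Omega> (\<Phi> l) = L \<longrightarrow> basis_coeff d \<Phi> p l = 0)"

definition objective ::
  "(real ^ 's::finite) set \<Rightarrow> nat \<Rightarrow> nat \<Rightarrow> (nat \<Rightarrow> real ^ 's \<Rightarrow> real) \<Rightarrow>
   nat \<Rightarrow> (nat \<Rightarrow> real ^ 's) \<Rightarrow> (nat \<Rightarrow> real) \<Rightarrow> real \<Rightarrow> (nat \<Rightarrow> real) \<Rightarrow>
   (real ^ 's \<Rightarrow> real) \<Rightarrow> (real ^ 's \<Rightarrow> real) \<Rightarrow> real" where
  "objective \<Omega> L d \<Phi> N x w lam \<mu> f p =
     1/2 * (\<Sum>j=1..N. w j * (p (x j) - f (x j))\<^sup>2)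
     + 1/2 * (\<Sum>j=1..N. w j * (reg_op \<Omega> L d \<Phi> p (x j))\<^sup>2)
     + lam * (\<Sum>l=1..d. \<mu> l * \<bar>basis_coeff d \<Phi> p l\<bar>)"

end

theory Submission imports Defs begin

text \<open>
  In an orthonormal basis the minimization separates into one problem per coefficient.  The product of
  two polynomials of degree at most \<open>L\<close> has degree at most \<open>2L\<close>, so a quadrature rule that is exact of
  degree \<open>2L\<close> turns the orthonormality of the \<open>\<Phi>\<^sub>l\<close> into orthonormality for the discrete scalar
  product (\<open>discrete_ip_orthonormal\<close>).  By Parseval, the objective at
  \<open>p = \<Sum>\<^sub>l \<beta>\<^sub>l \<Phi>\<^sub>l\<close>, with \<open>\<alpha>\<^sub>l = \<langle>f, \<Phi>\<^sub>l\<rangle>\<^sub>N\<close>, is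
  a constant plus
  \<open>\<Sum>\<^sub>l ((1 + b\<^sub>l\<^sup>2) / 2 * \<beta>\<^sub>l\<^sup>2 - \<alpha>\<^sub>l * \<beta>\<^sub>l + \<lambda> * \<mu>\<^sub>l * \<bar>\<beta>\<^sub>l\<bar>)\<close>
  (\<open>objective_separates\<close>).

  The coefficients \<open>b\<^sub>l\<close> are made so that \<open>1 + b\<^sub>l\<^sup>2 = 1 / h\<^sub>l\<close> below degree \<open>L\<close>.  The scalar function
  \<open>t \<mapsto> t\<^sup>2 / (2 h) - \<alpha> t + k \<bar>t\<bar>\<close> is strongly convex, and its minimizer is the soft
  threshold \<open>S\<^sub>k(\<alpha>)\<close> shrunk by the factor \<open>h\<close> (\<open>soft_threshold_strong_minimum\<close>).  In degree \<open>L\<close> both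
  the constraint and \<open>h(1) = 0\<close> force the coefficient \<open>0\<close>.  Since \<open>h \<le> 1\<close>, summation shows that the
  objective at an admissible \<open>p\<close> exceeds its value at the hybrid hyperinterpolant by at least half the
  squared distance of the coefficient vectors; this gives minimality and uniqueness at once.
\<close>

section \<open>The filter and the one-dimensional problem\<close>

text \<open>
  With \<open>s = S\<^sub>k(a)\<close>, the number \<open>a - s\<close> is a subgradient of \<open>k \<bar>t\<bar>\<close> at \<open>s\<close>, hence also at \<open>h s\<close>: it lies
  in \<open>[-k, k]\<close> and satisfies \<open>(a - s) s = k \<bar>s\<bar>\<close>.  Completing the square leaves exactly this
  subgradient inequality.  The quadratic excess on the right is what yields uniqueness.
\<close>
lemma soft_threshold_strong_minimum:
  fixes a h k t :: real
  assumes "0 < h" "0 \<le> k"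
  defines "m \<equiv> h * soft_threshold k a"
  shows "m\<^sup>2 / (2 * h) - a * m + k * \<bar>m\<bar> + (t - m)\<^sup>2 / (2 * h)
           \<le> t\<^sup>2 / (2 * h) - a * t + k * \<bar>t\<bar>"
proof -
  define s where "s = soft_threshold k a"
  have dev: "\<bar>a - s\<bar> \<le> k" and sub: "(a - s) * s = k * \<bar>s\<bar>"
    using assms(2) unfolding s_def soft_threshold_def by (auto simp: abs_if algebra_simps)
  have "(a - s) * t \<le> \<bar>a - s\<bar> * \<bar>t\<bar>"
    by (metis abs_ge_self abs_mult)
  also have "\<dots> \<le> k * \<bar>t\<bar>"
    using dev by (intro mult_right_mono) auto
  finally have ineq: "(a - s) * t \<le> k * \<bar>t\<bar>" .
  have "k * \<bar>m\<bar> = h * (k * \<bar>s\<bar>)"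
    using assms(1) by (simp add: m_def s_def abs_mult)
  then have km: "k * \<bar>m\<bar> = h * ((a - s) * s)"
    using sub by simp
  have sq: "(t - m)\<^sup>2 / (2 * h) = t\<^sup>2 / (2 * h) - t * s + h * s\<^sup>2 / 2"
    "m\<^sup>2 / (2 * h) = h * s\<^sup>2 / 2"
    using assms(1) by (simp_all add: m_def s_def[symmetric] power2_eq_square field_simps)
  show ?thesis
    unfolding km sq using ineq
    by (simp add: m_def s_def[symmetric] power2_eq_square algebra_simps)
qed

lemma filter_h_pos:
  assumes "t < 1"
  shows "0 < filter_h t"
proof (cases "t \<le> 1/2")
  case False
  then have "0 < sin (pi * t)"
    using assms by (intro sin_gt_zero) auto
  then show ?thesis
    using False by (simp add: filter_h_def)
qed (simp add: filter_h_def)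

lemma filter_h_le_1: "filter_h t \<le> 1"
  by (simp add: filter_h_def abs_square_le_1)

lemma filter_h_1: "filter_h 1 = 0"
  by (simp add: filter_h_def)

lemma reg_coeff_eq:
  assumes "k < L"
  shows "1 + (reg_coeff L k)\<^sup>2 = 1 / filter_h (real k / real L)"
proof (cases "real k / real L \<le> 1/2")
  case True
  then show ?thesis by (simp add: reg_coeff_def filter_h_def)
next
  case False
  have "0 < filter_h (real k / real L)"
    using assms by (intro filter_h_pos) (simp add: field_simps)
  then have "0 \<le> 1 / filter_h (real k / real L) - 1"
    using filter_h_le_1[of "real k / real L"] by (simp add: field_simps)
  then show ?thesis
    using False by (simp add: reg_coeff_def)
qed

section \<open>Products of polynomials\<close>

lemma sum_fun_apply:
  fixes F :: "'i \<Rightarrow> 'a \<Rightarrow> 'b::comm_monoid_add"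
  shows "(\<Sum>i\<in>A. F i) y = (\<Sum>i\<in>A. F i y)"
  by (induction A rule: infinite_finite_induct) auto

lemma restr_mult: "restr \<Omega> (\<lambda>y. p y * q y) = (\<lambda>y. restr \<Omega> p y * restr \<Omega> q y)"
  by (auto simp: restr_def)

text \<open>
  Multiplication is bilinear, so a product of two spans stays in a subspace as soon as the products of
  the generators do.
\<close>
lemma fun_vs_span_mult:
  assumes "p \<in> fun_vs.span A" "q \<in> fun_vs.span B"
    and gen: "\<And>a b. a \<in> A \<Longrightarrow> b \<in> B \<Longrightarrow> (\<lambda>y. a y * b y) \<in> fun_vs.span C"
  shows "(\<lambda>y. p y * q y) \<in> fun_vs.span C"
proof -
  have left: "(\<lambda>y. p y * b y) \<in> fun_vs.span C" if "b \<in> B" for b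
    using assms(1)
  proof (induction rule: fun_vs.span_induct_alt)
    case base
    then show ?case using fun_vs.span_zero[of C] by (simp add: zero_fun_def)
  next
    case (step c a r)
    have "fun_scale c (\<lambda>y. a y * b y) + (\<lambda>y. r y * b y) \<in> fun_vs.span C"
      using step gen[OF _ that] by (intro fun_vs.span_add fun_vs.span_scale) auto
    moreover have "fun_scale c (\<lambda>y. a y * b y) + (\<lambda>y. r y * b y)
        = (\<lambda>y. (fun_scale c a + r) y * b y)"
      by (auto simp: fun_scale_def algebra_simps)
    ultimately show ?case by simp
  qed
  show ?thesis
    using assms(2)
  proof (induction rule: fun_vs.span_induct_alt)
    case base
    then show ?case using fun_vs.span_zero[of C] by (simp add: zero_fun_def)
  next
    case (step c b r)
    have "fun_scale c (\<lambda>y. p y * b y) + (\<lambda>y. p y * r y) \<in> fun_vs.span C"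
      using step left by (intro fun_vs.span_add fun_vs.span_scale) auto
    moreover have "fun_scale c (\<lambda>y. p y * b y) + (\<lambda>y. p y * r y)
        = (\<lambda>y. p y * (fun_scale c b + r) y)"
      by (auto simp: fun_scale_def algebra_simps)
    ultimately show ?case by simp
  qed
qed

lemma monomial_mult: "monomial a y * monomial b y = monomial (\<lambda>i. a i + b i) y"
  by (simp add: monomial_def power_add prod.distrib)

lemma poly_space_mult:
  fixes \<Omega> :: "(real ^ 's::finite) set"
  assumes "p \<in> poly_space m \<Omega>" "q \<in> poly_space n \<Omega>"
  shows "(\<lambda>y. p y * q y) \<in> poly_space (m + n) \<Omega>"
proof -
  let ?M = "\<lambda>n. {monomial a |a :: 's \<Rightarrow> nat. (\<Sum>i\<in>UNIV. a i) \<le> n}"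
  obtain p' q' where p': "p' \<in> fun_vs.span (?M m)" "p = restr \<Omega> p'"
    and q': "q' \<in> fun_vs.span (?M n)" "q = restr \<Omega> q'"
    using assms unfolding poly_space_def by blast
  have "(\<lambda>y. p' y * q' y) \<in> fun_vs.span (?M (m + n))"
  proof (rule fun_vs_span_mult[OF p'(1) q'(1)])
    fix P Q assume "P \<in> ?M m" "Q \<in> ?M n"
    then obtain a b where "P = monomial a" "(\<Sum>i\<in>UNIV. a i) \<le> m"
      "Q = monomial b" "(\<Sum>i\<in>UNIV. b i) \<le> n" by blast
    then have "(\<lambda>y. P y * Q y) = monomial (\<lambda>i. a i + b i)"
      "(\<Sum>i\<in>UNIV. a i + b i) \<le> m + n"
      by (auto simp: monomial_mult sum.distrib)
    then show "(\<lambda>y. P y * Q y) \<in> fun_vs.span (?M (m + n))"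
      by (intro fun_vs.span_base) blast
  qed
  then have "restr \<Omega> (\<lambda>y. p' y * q' y) \<in> poly_space (m + n) \<Omega>"
    unfolding poly_space_def by (rule imageI)
  then show ?thesis
    by (simp only: restr_mult p'(2) q'(2))
qed

section \<open>Coefficients and discrete orthonormality\<close>

lemma orthonormal_poly_basis_mem:
  assumes "orthonormal_poly_basis \<Omega> \<omega> L d \<Phi>" "l \<in> {1..d}"
  shows "\<Phi> l \<in> poly_space L \<Omega>"
  using assms fun_vs.span_base[of "\<Phi> l" "\<Phi> ` {1..d}"]
  unfolding orthonormal_poly_basis_def by auto

lemma linear_combination_mem:
  assumes "orthonormal_poly_basis \<Omega> \<omega> L d \<Phi>"
  shows "(\<lambda>y. \<Sum>l=1..d. c l * \<Phi> l y) \<in> poly_space L \<Omega>"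
proof -
  have "(\<Sum>l=1..d. fun_scale (c l) (\<Phi> l)) \<in> fun_vs.span (\<Phi> ` {1..d})"
    by (intro fun_vs.span_sum fun_vs.span_scale fun_vs.span_base) auto
  moreover have "(\<Sum>l=1..d. fun_scale (c l) (\<Phi> l)) = (\<lambda>y. \<Sum>l=1..d. c l * \<Phi> l y)"
    by (auto simp: sum_fun_apply fun_scale_def)
  moreover have "fun_vs.span (\<Phi> ` {1..d}) = poly_space L \<Omega>"
    using assms unfolding orthonormal_poly_basis_def by blast
  ultimately show ?thesis
    by (simp only:)
qed

lemma basis_expansion:
  assumes "orthonormal_poly_basis \<Omega> \<omega> L d \<Phi>" "p \<in> poly_space L \<Omega>"
  shows "p = (\<lambda>y. \<Sum>l=1..d. basis_coeff d \<Phi> p l * \<Phi> l y)"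
proof -
  have inj: "inj_on \<Phi> {1..d}" and ind: "fun_vs.independent (\<Phi> ` {1..d})"
    and mem: "p \<in> fun_vs.span (\<Phi> ` {1..d})"
    using assms unfolding orthonormal_poly_basis_def by auto
  have "p = (\<Sum>b\<in>\<Phi> ` {1..d}. fun_scale (fun_vs.representation (\<Phi> ` {1..d}) p b) b)"
    using fun_vs.sum_representation_eq[OF ind mem] by simp
  also have "\<dots> = (\<Sum>l=1..d. fun_scale (basis_coeff d \<Phi> p l) (\<Phi> l))"
    unfolding basis_coeff_def sum.reindex[OF inj] comp_def ..
  also have "\<dots> = (\<lambda>y. \<Sum>l=1..d. basis_coeff d \<Phi> p l * \<Phi> l y)"
    by (auto simp: sum_fun_apply fun_scale_def)
  finally show ?thesis .
qed

lemma basis_coeff_linear_combination: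
  assumes "orthonormal_poly_basis \<Omega> \<omega> L d \<Phi>" "k \<in> {1..d}"
  shows "basis_coeff d \<Phi> (\<lambda>y. \<Sum>l=1..d. c l * \<Phi> l y) k = c k"
proof -
  let ?B = "\<Phi> ` {1..d}"
  have inj: "inj_on \<Phi> {1..d}" and ind: "fun_vs.independent ?B"
    using assms unfolding orthonormal_poly_basis_def by auto
  have mem: "\<Phi> l \<in> fun_vs.span ?B" if "l \<in> {1..d}" for l
    using that by (intro fun_vs.span_base) auto
  have "(\<lambda>y. \<Sum>l=1..d. c l * \<Phi> l y) = (\<Sum>l=1..d. fun_scale (c l) (\<Phi> l))"
    by (auto simp: sum_fun_apply fun_scale_def)
  then have "basis_coeff d \<Phi> (\<lambda>y. \<Sum>l=1..d. c l * \<Phi> l y) k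
      = fun_vs.representation ?B (\<Sum>l=1..d. fun_scale (c l) (\<Phi> l)) (\<Phi> k)"
    by (simp add: basis_coeff_def)
  also have "\<dots> = (\<Sum>l=1..d. fun_vs.representation ?B (fun_scale (c l) (\<Phi> l)) (\<Phi> k))"
    by (subst fun_vs.representation_sum[OF ind]) (intro fun_vs.span_scale mem, assumption, rule refl)
  also have "\<dots> = (\<Sum>l=1..d. c l * (if \<Phi> l = \<Phi> k then 1 else 0))"
  proof (intro sum.cong refl)
    fix l assume l: "l \<in> {1..d}"
    have "fun_vs.representation ?B (\<Phi> l) (\<Phi> k) = (if \<Phi> l = \<Phi> k then 1 else 0)"
      unfolding fun_vs.representation_basis[OF ind imageI[OF l]] by auto
    then show "fun_vs.representation ?B (fun_scale (c l) (\<Phi> l)) (\<Phi> k)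
        = c l * (if \<Phi> l = \<Phi> k then 1 else 0)"
      unfolding fun_vs.representation_scale[OF ind mem[OF l]] by simp
  qed
  also have "\<dots> = (\<Sum>l=1..d. if l = k then c l else 0)"
    using assms(2) by (intro sum.cong refl) (auto dest: inj_onD[OF inj])
  also have "\<dots> = c k"
    using assms(2) by simp
  finally show ?thesis .
qed

text \<open>
  The integrand \<open>\<Phi>\<^sub>k \<Phi>\<^sub>l\<close> of the scalar product lies in the space on which the quadrature is exact; this
  is where the degree of exactness \<open>2L\<close> enters.
\<close>
lemma discrete_ip_orthonormal:
  assumes basis: "orthonormal_poly_basis \<Omega> \<omega> L d \<Phi>"
    and exact: "exact_of_degree \<Omega> \<omega> N x w (2 * L)"
    and kl: "k \<in> {1..d}" "l \<in> {1..d}"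
  shows "discrete_ip N x w (\<Phi> k) (\<Phi> l) = (if k = l then 1 else 0)"
proof -
  have "(\<lambda>y. \<Phi> k y * \<Phi> l y) \<in> poly_space (2 * L) \<Omega>"
    using poly_space_mult[OF orthonormal_poly_basis_mem[OF basis kl(1)]
        orthonormal_poly_basis_mem[OF basis kl(2)]]
    by (simp add: mult_2)
  with exact have "(\<Sum>j=1..N. w j * (\<Phi> k (x j) * \<Phi> l (x j))) = integral\<^sup>L \<omega> (\<lambda>y. \<Phi> k y * \<Phi> l y)"
    unfolding exact_of_degree_def by (rule bspec)
  then have "discrete_ip N x w (\<Phi> k) (\<Phi> l) = ip \<omega> (\<Phi> k) (\<Phi> l)"
    unfolding discrete_ip_def ip_def mult.assoc .
  then show ?thesis
    using basis kl unfolding orthonormal_poly_basis_def by simp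
qed

lemma discrete_ip_sum_right:
  "discrete_ip N x w f (\<lambda>y. \<Sum>l\<in>A. c l * g l y) = (\<Sum>l\<in>A. c l * discrete_ip N x w f (g l))"
proof -
  have "discrete_ip N x w f (\<lambda>y. \<Sum>l\<in>A. c l * g l y)
      = (\<Sum>j=1..N. \<Sum>l\<in>A. c l * (w j * f (x j) * g l (x j)))"
    unfolding discrete_ip_def by (simp add: sum_distrib_left mult_ac)
  also have "\<dots> = (\<Sum>l\<in>A. c l * discrete_ip N x w f (g l))"
    unfolding discrete_ip_def by (subst sum.swap) (simp add: sum_distrib_left)
  finally show ?thesis .
qed

lemma discrete_ip_commute: "discrete_ip N x w f g = discrete_ip N x w g f"
  by (simp add: discrete_ip_def mult_ac)

lemma discrete_parseval:
  assumes orth: "\<And>k l. k \<in> A \<Longrightarrow> l \<in> A \<Longrightarrow>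
      discrete_ip N x w (g k) (g l) = (if k = l then 1 else 0)"
    and "finite A"
  shows "discrete_ip N x w (\<lambda>y. \<Sum>l\<in>A. c l * g l y) (\<lambda>y. \<Sum>l\<in>A. c l * g l y) = (\<Sum>l\<in>A. (c l)\<^sup>2)"
proof -
  have coeff: "discrete_ip N x w (\<lambda>y. \<Sum>k\<in>A. c k * g k y) (g l) = c l" if "l \<in> A" for l
  proof -
    have "discrete_ip N x w (\<lambda>y. \<Sum>k\<in>A. c k * g k y) (g l)
        = (\<Sum>k\<in>A. c k * discrete_ip N x w (g l) (g k))"
      by (subst discrete_ip_commute) (rule discrete_ip_sum_right)
    also have "\<dots> = (\<Sum>k\<in>A. if k = l then c k else 0)"
      using that by (intro sum.cong refl) (auto simp: orth)
    finally show ?thesis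
      using that \<open>finite A\<close> by simp
  qed
  show ?thesis
    by (simp add: discrete_ip_sum_right coeff power2_eq_square)
qed

section \<open>Minimization of the objective\<close>

text \<open>
  The regularization operator is diagonal in the basis, so Parseval applies to both quadratic terms of
  the objective.  Setting the factor \<open>e l\<close> to zero in degree \<open>L\<close> implements the convention on infinite
  coefficients.
\<close>
lemma objective_separates:
  assumes basis: "orthonormal_poly_basis \<Omega> \<omega> L d \<Phi>"
    and exact: "exact_of_degree \<Omega> \<omega> N x w (2 * L)"
    and p: "p \<in> poly_space L \<Omega>"
  defines "\<beta> \<equiv> basis_coeff d \<Phi> p"
    and "e \<equiv> \<lambda>l. if total_deg \<Omega> (\<Phi> l) = L then 0 else reg_coeff L (total_deg \<Omega> (\<Phi> l))"
  shows "objective \<Omega> L d \<Phi> N x w lam \<mu> f p = discrete_ip N x w f f / 2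
    + (\<Sum>l=1..d. (1 + (e l)\<^sup>2) / 2 * (\<beta> l)\<^sup>2 - discrete_ip N x w f (\<Phi> l) * \<beta> l
        + lam * \<mu> l * \<bar>\<beta> l\<bar>)"
proof -
  have orth: "discrete_ip N x w (\<Phi> k) (\<Phi> l) = (if k = l then 1 else 0)"
    if "k \<in> {1..d}" "l \<in> {1..d}" for k l
    using discrete_ip_orthonormal[OF basis exact that] .
  have p_eq: "p = (\<lambda>y. \<Sum>l=1..d. \<beta> l * \<Phi> l y)"
    unfolding \<beta>_def by (rule basis_expansion[OF basis p])
  have R_eq: "reg_op \<Omega> L d \<Phi> p = (\<lambda>y. \<Sum>l=1..d. (e l * \<beta> l) * \<Phi> l y)"
    unfolding reg_op_def \<beta>_def e_def by (intro ext sum.cong) auto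
  have pp: "discrete_ip N x w p p = (\<Sum>l=1..d. (\<beta> l)\<^sup>2)"
    unfolding p_eq by (rule discrete_parseval) (auto simp: orth)
  have fp: "discrete_ip N x w f p = (\<Sum>l=1..d. \<beta> l * discrete_ip N x w f (\<Phi> l))"
    unfolding p_eq by (rule discrete_ip_sum_right)
  have "(\<Sum>j=1..N. w j * (reg_op \<Omega> L d \<Phi> p (x j))\<^sup>2)
      = discrete_ip N x w (reg_op \<Omega> L d \<Phi> p) (reg_op \<Omega> L d \<Phi> p)"
    by (simp add: discrete_ip_def power2_eq_square mult.assoc)
  also have "\<dots> = (\<Sum>l=1..d. (e l * \<beta> l)\<^sup>2)"
    unfolding R_eq by (rule discrete_parseval) (auto simp: orth)
  finally have RR: "(\<Sum>j=1..N. w j * (reg_op \<Omega> L d \<Phi> p (x j))\<^sup>2) = (\<Sum>l=1..d. (e l * \<beta> l)\<^sup>2)" .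
  have "(\<Sum>j=1..N. w j * (p (x j) - f (x j))\<^sup>2)
      = (\<Sum>j=1..N. w j * f (x j) * f (x j) - 2 * (w j * f (x j) * p (x j)) + w j * p (x j) * p (x j))"
    by (intro sum.cong) (auto simp: power2_eq_square algebra_simps)
  also have "\<dots> = discrete_ip N x w f f - 2 * discrete_ip N x w f p + discrete_ip N x w p p"
    by (simp add: discrete_ip_def sum.distrib sum_subtractf sum_distrib_left)
  finally have LS: "(\<Sum>j=1..N. w j * (p (x j) - f (x j))\<^sup>2)
      = discrete_ip N x w f f - 2 * discrete_ip N x w f p + discrete_ip N x w p p" .
  have "objective \<Omega> L d \<Phi> N x w lam \<mu> f p = discrete_ip N x w f f / 2
      + (1/2 * (\<Sum>l=1..d. (\<beta> l)\<^sup>2) - (\<Sum>l=1..d. \<beta> l * discrete_ip N x w f (\<Phi> l))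
         + 1/2 * (\<Sum>l=1..d. (e l * \<beta> l)\<^sup>2) + lam * (\<Sum>l=1..d. \<mu> l * \<bar>\<beta> l\<bar>))"
    unfolding objective_def LS RR pp fp \<beta>_def by simp
  also have "1/2 * (\<Sum>l=1..d. (\<beta> l)\<^sup>2) - (\<Sum>l=1..d. \<beta> l * discrete_ip N x w f (\<Phi> l))
         + 1/2 * (\<Sum>l=1..d. (e l * \<beta> l)\<^sup>2) + lam * (\<Sum>l=1..d. \<mu> l * \<bar>\<beta> l\<bar>)
      = (\<Sum>l=1..d. 1/2 * (\<beta> l)\<^sup>2 - \<beta> l * discrete_ip N x w f (\<Phi> l)
         + 1/2 * (e l * \<beta> l)\<^sup>2 + lam * (\<mu> l * \<bar>\<beta> l\<bar>))"
    by (simp add: sum.distrib sum_subtractf sum_distrib_left)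
  also have "\<dots> = (\<Sum>l=1..d. (1 + (e l)\<^sup>2) / 2 * (\<beta> l)\<^sup>2 - discrete_ip N x w f (\<Phi> l) * \<beta> l
        + lam * \<mu> l * \<bar>\<beta> l\<bar>)"
    by (intro sum.cong) (auto simp: power_mult_distrib field_simps)
  finally show ?thesis .
qed

lemma total_deg_basis_le:
  assumes "orthonormal_poly_basis \<Omega> \<omega> L d \<Phi>" "l \<in> {1..d}"
  shows "total_deg \<Omega> (\<Phi> l) \<le> L"
  unfolding total_deg_def by (rule Least_le) (rule orthonormal_poly_basis_mem[OF assms])

text \<open>
  Below degree \<open>L\<close> the scalar estimate applies in each coordinate, and its excess dominates
  \<open>(t - m)\<^sup>2 / 2\<close> because the filter is at most \<open>1\<close>; in degree \<open>L\<close> both coefficients vanish.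
\<close>
lemma objective_quadratic_growth:
  fixes f :: "real ^ 's::finite \<Rightarrow> real"
  assumes "L \<ge> 1"
    and basis: "orthonormal_poly_basis \<Omega> \<omega> L d \<Phi>"
    and exact: "exact_of_degree \<Omega> \<omega> N x w (2 * L)"
    and "lam \<ge> 0" and "\<And>l. l \<in> {1..d} \<Longrightarrow> \<mu> l \<ge> 0"
    and adm: "admissible \<Omega> L d \<Phi> p"
  defines "H \<equiv> hybrid_hyperinterpolant \<Omega> L d \<Phi> N x w lam \<mu> f"
  shows "objective \<Omega> L d \<Phi> N x w lam \<mu> f H
      + (\<Sum>l=1..d. (basis_coeff d \<Phi> p l - basis_coeff d \<Phi> H l)\<^sup>2) / 2
    \<le> objective \<Omega> L d \<Phi> N x w lam \<mu> f p"
proof -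
  define \<alpha> where "\<alpha> l = discrete_ip N x w f (\<Phi> l)" for l
  define e where
    "e l = (if total_deg \<Omega> (\<Phi> l) = L then 0 else reg_coeff L (total_deg \<Omega> (\<Phi> l)))" for l
  define h where "h l = filter_h (real (total_deg \<Omega> (\<Phi> l)) / real L)" for l
  define \<gamma> where "\<gamma> l = h l * soft_threshold (lam * \<mu> l) (\<alpha> l)" for l
  define E where "E l t = (1 + (e l)\<^sup>2) / 2 * t\<^sup>2 - \<alpha> l * t + lam * \<mu> l * \<bar>t\<bar>" for l t
  define \<beta> where "\<beta> = basis_coeff d \<Phi> p"
  have H_eq: "H = (\<lambda>y. \<Sum>l=1..d. \<gamma> l * \<Phi> l y)"
    by (simp add: H_def hybrid_hyperinterpolant_def \<gamma>_def h_def \<alpha>_def)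
  have H_mem: "H \<in> poly_space L \<Omega>"
    unfolding H_eq by (rule linear_combination_mem[OF basis])
  have H_coeff: "basis_coeff d \<Phi> H l = \<gamma> l" if "l \<in> {1..d}" for l
    unfolding H_eq by (rule basis_coeff_linear_combination[OF basis that])
  have sep: "objective \<Omega> L d \<Phi> N x w lam \<mu> f q = discrete_ip N x w f f / 2
      + (\<Sum>l=1..d. E l (basis_coeff d \<Phi> q l))" if "q \<in> poly_space L \<Omega>" for q
    using objective_separates[OF basis exact that] by (simp add: E_def e_def \<alpha>_def)
  have coord: "E l (\<gamma> l) + (\<beta> l - \<gamma> l)\<^sup>2 / 2 \<le> E l (\<beta> l)" if l: "l \<in> {1..d}" for l
  proof (cases "total_deg \<Omega> (\<Phi> l) = L")
    case True
    then have "\<beta> l = 0"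
      using adm l unfolding admissible_def \<beta>_def by blast
    moreover have "\<gamma> l = 0"
      using True \<open>L \<ge> 1\<close> by (simp add: \<gamma>_def h_def filter_h_1)
    ultimately show ?thesis by simp
  next
    case False
    then have less: "total_deg \<Omega> (\<Phi> l) < L"
      using total_deg_basis_le[OF basis l] by simp
    have h: "0 < h l" "h l \<le> 1"
      using less by (auto simp: h_def filter_h_le_1 intro!: filter_h_pos)
    have "1 + (e l)\<^sup>2 = 1 / h l"
      using False reg_coeff_eq[OF less] by (simp add: e_def h_def)
    then have E_eq: "E l t = t\<^sup>2 / (2 * h l) - \<alpha> l * t + lam * \<mu> l * \<bar>t\<bar>" for t
      by (simp add: E_def)
    have "(\<beta> l - \<gamma> l)\<^sup>2 / 2 \<le> (\<beta> l - \<gamma> l)\<^sup>2 / (2 * h l)"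
      using h by (intro divide_left_mono) auto
    moreover have "E l (\<gamma> l) + (\<beta> l - \<gamma> l)\<^sup>2 / (2 * h l) \<le> E l (\<beta> l)"
      using soft_threshold_strong_minimum[OF h(1), of "lam * \<mu> l" "\<alpha> l" "\<beta> l"] assms(4) assms(5)[OF l]
      by (simp add: E_eq \<gamma>_def)
    ultimately show ?thesis by linarith
  qed
  have "(\<Sum>l=1..d. E l (\<gamma> l)) + (\<Sum>l=1..d. (\<beta> l - \<gamma> l)\<^sup>2) / 2 \<le> (\<Sum>l=1..d. E l (\<beta> l))"
    unfolding sum_divide_distrib sum.distrib[symmetric] using coord by (intro sum_mono)
  then show ?thesis
    using adm sep[OF H_mem] sep[of p] H_coeff
    by (simp add: admissible_def \<beta>_def)
qed

theorem theorem3p1: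
  fixes \<Omega> :: "(real ^ 's::finite) set"
    and \<omega> :: "(real ^ 's) measure"
    and L d N :: nat
    and \<Phi> :: "nat \<Rightarrow> real ^ 's \<Rightarrow> real"
    and x :: "nat \<Rightarrow> real ^ 's"
    and w \<mu> :: "nat \<Rightarrow> real"
    and lam :: real
    and f :: "real ^ 's \<Rightarrow> real"
  assumes "compact \<Omega>"
    and "finite_measure_on \<Omega> \<omega>"
    and "L \<ge> 1"
    and "orthonormal_poly_basis \<Omega> \<omega> L d \<Phi>"
    and "positive_quadrature \<Omega> N x w"
    and "exact_of_degree \<Omega> \<omega> N x w (2 * L)"
    and "continuous_on \<Omega> f"
    and "lam > 0"
    and "\<And>l. l \<in> {1..d} \<Longrightarrow> \<mu> l > 0"
  shows "hybrid_hyperinterpolant \<Omega> L d \<Phi> N x w lam \<mu> f \<in> poly_space L \<Omega> \<and>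
    {p. is_arg_min (objective \<Omega> L d \<Phi> N x w lam \<mu> f) (admissible \<Omega> L d \<Phi>) p}
      = {hybrid_hyperinterpolant \<Omega> L d \<Phi> N x w lam \<mu> f}"
proof -
  define H where "H = hybrid_hyperinterpolant \<Omega> L d \<Phi> N x w lam \<mu> f"
  let ?J = "objective \<Omega> L d \<Phi> N x w lam \<mu> f"
  define \<gamma> where "\<gamma> l = filter_h (real (total_deg \<Omega> (\<Phi> l)) / real L)
    * soft_threshold (lam * \<mu> l) (discrete_ip N x w f (\<Phi> l))" for l
  note basis = assms(4)
  have H_eq: "H = (\<lambda>y. \<Sum>l=1..d. \<gamma> l * \<Phi> l y)"
    by (simp add: H_def hybrid_hyperinterpolant_def \<gamma>_def)
  have H_mem: "H \<in> poly_space L \<Omega>"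
    unfolding H_eq by (rule linear_combination_mem[OF basis])
  have H_adm: "admissible \<Omega> L d \<Phi> H"
    unfolding admissible_def
  proof (intro conjI ballI impI H_mem)
    fix l assume "l \<in> {1..d}" "total_deg \<Omega> (\<Phi> l) = L"
    moreover from this have "\<gamma> l = 0"
      using \<open>L \<ge> 1\<close> by (simp add: \<gamma>_def filter_h_1)
    ultimately show "basis_coeff d \<Phi> H l = 0"
      unfolding H_eq by (simp only: basis_coeff_linear_combination[OF basis])
  qed
  have growth: "?J H + (\<Sum>l=1..d. (basis_coeff d \<Phi> p l - basis_coeff d \<Phi> H l)\<^sup>2) / 2 \<le> ?J p"
    if "admissible \<Omega> L d \<Phi> p" for p
    unfolding H_def
    by (rule objective_quadratic_growth[OF assms(3) basis assms(6) _ _ that])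
       (use assms(8,9) in \<open>auto intro: less_imp_le\<close>)
  have "is_arg_min ?J (admissible \<Omega> L d \<Phi>) H"
    unfolding is_arg_min_linorder
  proof (intro conjI allI impI H_adm)
    fix p assume "admissible \<Omega> L d \<Phi> p"
    from growth[OF this] show "?J H \<le> ?J p"
      using sum_nonneg[of "{1..d}" "\<lambda>l. (basis_coeff d \<Phi> p l - basis_coeff d \<Phi> H l)\<^sup>2"] by simp
  qed
  moreover have "p = H" if min: "is_arg_min ?J (admissible \<Omega> L d \<Phi>) p" for p
  proof -
    let ?D = "\<lambda>l. (basis_coeff d \<Phi> p l - basis_coeff d \<Phi> H l)\<^sup>2"
    have adm: "admissible \<Omega> L d \<Phi> p" and le: "?J p \<le> ?J H"
      using min H_adm by (auto simp: is_arg_min_linorder)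
    have "(\<Sum>l=1..d. ?D l) \<le> 0"
      using growth[OF adm] le by simp
    then have "(\<Sum>l=1..d. ?D l) = 0"
      using sum_nonneg[of "{1..d}" ?D] by simp
    then have coeff: "basis_coeff d \<Phi> p l = basis_coeff d \<Phi> H l" if "l \<in> {1..d}" for l
      using that by (subst (asm) sum_nonneg_eq_0_iff) auto
    have "p = (\<lambda>y. \<Sum>l=1..d. basis_coeff d \<Phi> p l * \<Phi> l y)"
      using adm by (intro basis_expansion[OF basis]) (simp add: admissible_def)
    also have "\<dots> = (\<lambda>y. \<Sum>l=1..d. basis_coeff d \<Phi> H l * \<Phi> l y)"
      by (simp add: coeff)
    also have "\<dots> = H"
      using basis_expansion[OF basis H_mem] by simp
    finally show ?thesis .
  qed
  ultimately show ?thesis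
    using H_mem unfolding H_def by blast
qed

end
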